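(* Consider the one-dimensional semi-discrete finite volume scheme $$\frac{d\bar c_{m,j}(t)}{dt}=-\frac{F_{m,j+\frac12}(t)-F_{m,j-\frac12}(t)}{\Delta x_j},\qquad m=1,\dots,M,\ \ j=-M_x,\dots,M_x,$$ on $[-L,L]$, with the upwind fluxes $F_{m,j+\frac12}$ defined in the context and initial data $c_m^0(x)\ge0$, $m=1,\dots,M$. Assume no-flux boundary conditions, i.e. $F_{m,-M_x-\frac12}=F_{m,M_x+\frac12}=0$ for $m=1,\dots,M$. Define the discrete free energy and the discrete dissipation $$E_\Delta(t)=\sum_{m=1}^M\sum_j\Delta x_j\,\bar c_{m,j}\log\bar c_{m,j}+\frac12\sum_{i,j}\Delta x_j\Delta x_i\big[\mathcal K(x_j-x_i)\rho_i\rho_j+\mathcal W(x_j-x_i)\theta_i\theta_j\big],$$ $$D_\Delta(t)=\sum_{m=1}^M\sum_j\Delta x_j\,\big(u_{m,j+\frac12}\big)^2\min\{\bar c_{m,j},\bar c_{m,j+1}\}.$$ Then $$\frac{d}{dt}E_\Delta(t)\le-D_\Delta(t)\le0,\qquad\forall\,t\ge0.$$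
   Context: The scheme discretizes the system $\partial_tc_m=\partial_x(c_m\,\partial_x\psi_m)$, $\psi_m=1+\log c_m+z_m\mathcal K*\rho+\mathcal W*\theta$, $\rho=\sum_mz_mc_m$, $\theta=\sum_mc_m$, $m=1,\dots,M$, with valences $z_m\in\mathbb Z$ and real-valued even kernels $\mathcal K,\mathcal W:\mathbb R\to\mathbb R$. Grid: $-L=x_{-M_x-\frac12}<x_{-M_x+\frac12}<\dots<x_{M_x+\frac12}=L$, cells $C_j=[x_{j-\frac12},x_{j+\frac12}]$ for $j=-M_x,\dots,M_x$, $\Delta x_j=x_{j+\frac12}-x_{j-\frac12}$, $x_j$ the center of $C_j$. The initial values $\bar c_{m,j}(0)$ are the cell averages of $c_m^0$. At each time: $\rho_j=\sum_{m=1}^Mz_m\bar c_{m,j}$, $\theta_j=\sum_{m=1}^M\bar c_{m,j}$, $$\psi_{m,j}=\log\bar c_{m,j}+1+\sum_i\Delta x_i\big[z_m\mathcal K(x_j-x_i)\rho_i+\mathcal W(x_j-x_i)\theta_i\big],$$ and, at interior interfaces ($-M_x\le j\le M_x-1$), $$u_{m,j+\frac12}=-\frac{\psi_{m,j+1}-\psi_{m,j}}{\Delta x_j},\quad u^+_{m,j+\frac12}=\max\{u_{m,j+\frac12},0\},\quad u^-_{m,j+\frac12}=-\min\{u_{m,j+\frac12},0\},$$ $$F_{m,j+\frac12}=u^+_{m,j+\frac12}\,\bar c_{m,j}-u^-_{m,j+\frac12}\,\bar c_{m,j+1}.$$ The sums over $i,j$ in $E_\Delta$ and $\psi_{m,j}$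 run over all cells; the sum over $j$ in $D_\Delta$ runs over the interior interfaces $-M_x\le j\le M_x-1$. A solution of the scheme means differentiable functions $\bar c_{m,j}:[0,\infty)\to(0,\infty)$ satisfying the ODE system $\frac{d\bar c_{m,j}}{dt}=-\frac{1}{\Delta x_j}\big(F_{m,j+\frac12}-F_{m,j-\frac12}\big)$ for $m=1,\dots,M$ and $j=-M_x,\dots,M_x$, with boundary fluxes $F_{m,-M_x-\frac12}=F_{m,M_x+\frac12}=0$ (positivity so that the logarithms are defined). *)

theory Defs
  imports "HOL-Analysis.Analysis"
begin

text \<open>
  Half-integer indices are shifted down: \<open>xh j\<close> is the interface \<open>x\<^sub>j\<^sub>+\<^sub>1\<^sub>/\<^sub>2\<close>, so that cell \<open>j\<close> is
  \<open>[xh (j - 1), xh j]\<close> and \<open>xh\<close> is only relevant on \<open>{-Mx-1..Mx}\<close>; likewise \<open>velocity \<dots> m j\<close>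
  and \<open>F m j\<close> live at the interface \<open>x\<^sub>j\<^sub>+\<^sub>1\<^sub>/\<^sub>2\<close>.  Species are numbered \<open>m = 1, \<dots>, M\<close>.

  A discrete state is \<open>c :: nat \<Rightarrow> int \<Rightarrow> real\<close>, with \<open>c m j\<close> the average of species \<open>m\<close> in
  cell \<open>j\<close>; a time-dependent state takes the time as its first argument.
\<close>

definition cells :: "nat \<Rightarrow> int set" where
  "cells Mx = {- int Mx .. int Mx}"

definition interior_interfaces :: "nat \<Rightarrow> int set" where
  "interior_interfaces Mx = {- int Mx .. int Mx - 1}"

definition is_grid :: "real \<Rightarrow> nat \<Rightarrow> (int \<Rightarrow> real) \<Rightarrow> bool" where
  "is_grid L Mx xh \<longleftrightarrow>
     xh (- int Mx - 1) = - L \<and> xh (int Mx) = L \<and> strict_mono_on {- int Mx - 1 .. int Mx} xh"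

definition cell :: "(int \<Rightarrow> real) \<Rightarrow> int \<Rightarrow> real set" where
  "cell xh j = {xh (j - 1) .. xh j}"

definition width :: "(int \<Rightarrow> real) \<Rightarrow> int \<Rightarrow> real" where
  "width xh j = xh j - xh (j - 1)"

definition center :: "(int \<Rightarrow> real) \<Rightarrow> int \<Rightarrow> real" where
  "center xh j = (xh (j - 1) + xh j) / 2"

definition cell_average :: "(int \<Rightarrow> real) \<Rightarrow> (real \<Rightarrow> real) \<Rightarrow> int \<Rightarrow> real" where
  "cell_average xh f j = integral (cell xh j) f / width xh j"

definition charge :: "nat \<Rightarrow> (nat \<Rightarrow> int) \<Rightarrow> (nat \<Rightarrow> int \<Rightarrow> real) \<Rightarrow> int \<Rightarrow> real" where
  "charge M z c j = (\<Sum>m = 1..M. real_of_int (z m) * c m j)"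

definition total :: "nat \<Rightarrow> (nat \<Rightarrow> int \<Rightarrow> real) \<Rightarrow> int \<Rightarrow> real" where
  "total M c j = (\<Sum>m = 1..M. c m j)"

definition potential ::
  "nat \<Rightarrow> (int \<Rightarrow> real) \<Rightarrow> nat \<Rightarrow> (nat \<Rightarrow> int) \<Rightarrow> (real \<Rightarrow> real) \<Rightarrow> (real \<Rightarrow> real) \<Rightarrow>
   (nat \<Rightarrow> int \<Rightarrow> real) \<Rightarrow> nat \<Rightarrow> int \<Rightarrow> real" where
  "potential Mx xh M z K W c m j =
     ln (c m j) + 1 +
     (\<Sum>i \<in> cells Mx. width xh i *
        (real_of_int (z m) * K (center xh j - center xh i) * charge M z c i
         + W (center xh j - center xh i) * total M c i))"

text \<open>The denominator is the width of cell \<open>j\<close>, also on non-uniform grids.\<close>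

definition velocity ::
  "nat \<Rightarrow> (int \<Rightarrow> real) \<Rightarrow> nat \<Rightarrow> (nat \<Rightarrow> int) \<Rightarrow> (real \<Rightarrow> real) \<Rightarrow> (real \<Rightarrow> real) \<Rightarrow>
   (nat \<Rightarrow> int \<Rightarrow> real) \<Rightarrow> nat \<Rightarrow> int \<Rightarrow> real" where
  "velocity Mx xh M z K W c m j =
     - (potential Mx xh M z K W c m (j + 1) - potential Mx xh M z K W c m j) / width xh j"

definition upwind_flux ::
  "nat \<Rightarrow> (int \<Rightarrow> real) \<Rightarrow> nat \<Rightarrow> (nat \<Rightarrow> int) \<Rightarrow> (real \<Rightarrow> real) \<Rightarrow> (real \<Rightarrow> real) \<Rightarrow>
   (nat \<Rightarrow> int \<Rightarrow> real) \<Rightarrow> nat \<Rightarrow> int \<Rightarrow> real" where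
  "upwind_flux Mx xh M z K W c m j =
     (let u = velocity Mx xh M z K W c m j; u_plus = max u 0; u_minus = - min u 0
      in u_plus * c m j - u_minus * c m (j + 1))"

text \<open>
  \<open>F t m j\<close> is the flux used at time \<open>t\<close>: the upwind flux at the interior interfaces.  Its
  values at the two boundary interfaces are left open here and are fixed by \<open>no_flux\<close>.
  At \<open>t = 0\<close> the time derivative is the right derivative.
\<close>

definition scheme_solution ::
  "nat \<Rightarrow> (int \<Rightarrow> real) \<Rightarrow> nat \<Rightarrow> (nat \<Rightarrow> int) \<Rightarrow> (real \<Rightarrow> real) \<Rightarrow> (real \<Rightarrow> real) \<Rightarrow>
   (real \<Rightarrow> nat \<Rightarrow> int \<Rightarrow> real) \<Rightarrow> (real \<Rightarrow> nat \<Rightarrow> int \<Rightarrow> real) \<Rightarrow> bool" where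
  "scheme_solution Mx xh M z K W F c \<longleftrightarrow>
     (\<forall>t \<ge> 0. \<forall>m \<in> {1..M}.
        (\<forall>j \<in> cells Mx. c t m j > 0) \<and>
        (\<forall>j \<in> interior_interfaces Mx. F t m j = upwind_flux Mx xh M z K W (c t) m j) \<and>
        (\<forall>j \<in> cells Mx. ((\<lambda>s. c s m j) has_real_derivative
             - (F t m j - F t m (j - 1)) / width xh j) (at t within {0..})))"

definition no_flux :: "nat \<Rightarrow> nat \<Rightarrow> (real \<Rightarrow> nat \<Rightarrow> int \<Rightarrow> real) \<Rightarrow> bool" where
  "no_flux Mx M F \<longleftrightarrow> (\<forall>t \<ge> 0. \<forall>m \<in> {1..M}. F t m (- int Mx - 1) = 0 \<and> F t m (int Mx) = 0)"

definition energy ::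
  "nat \<Rightarrow> (int \<Rightarrow> real) \<Rightarrow> nat \<Rightarrow> (nat \<Rightarrow> int) \<Rightarrow> (real \<Rightarrow> real) \<Rightarrow> (real \<Rightarrow> real) \<Rightarrow>
   (nat \<Rightarrow> int \<Rightarrow> real) \<Rightarrow> real" where
  "energy Mx xh M z K W c =
     (\<Sum>m = 1..M. \<Sum>j \<in> cells Mx. width xh j * c m j * ln (c m j)) +
     1 / 2 * (\<Sum>i \<in> cells Mx. \<Sum>j \<in> cells Mx. width xh j * width xh i *
       (K (center xh j - center xh i) * charge M z c i * charge M z c j
        + W (center xh j - center xh i) * total M c i * total M c j))"

definition dissipation ::
  "nat \<Rightarrow> (int \<Rightarrow> real) \<Rightarrow> nat \<Rightarrow> (nat \<Rightarrow> int) \<Rightarrow> (real \<Rightarrow> real) \<Rightarrow> (real \<Rightarrow> real) \<Rightarrow>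
   (nat \<Rightarrow> int \<Rightarrow> real) \<Rightarrow> real" where
  "dissipation Mx xh M z K W c =
     (\<Sum>m = 1..M. \<Sum>j \<in> interior_interfaces Mx.
        width xh j * (velocity Mx xh M z K W c m j)\<^sup>2 * min (c m j) (c m (j + 1)))"

end

theory Submission
  imports Defs
begin

text \<open>
  The potential is the gradient of the free energy: up to the cell width, \<open>\<psi>\<^sub>m\<^sub>,\<^sub>j\<close> is the
  derivative of the energy with respect to \<open>c\<^sub>m\<^sub>,\<^sub>j\<close>.  For the interaction terms this is where
  evenness of the kernels enters, since it makes their quadratic forms symmetric and so cancels
  the factor \<open>1/2\<close>.  Along any differentiable curve of positive states the energy therefore
  changes at the rate
  \<open>\<Sum>\<^sub>m \<Sum>\<^sub>j \<Delta>x\<^sub>j \<psi>\<^sub>m\<^sub>,\<^sub>j c'\<^sub>m\<^sub>,\<^sub>j\<close> (\<open>energy_has_derivative\<close>).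

  Along the scheme \<open>\<Delta>x\<^sub>j c'\<^sub>m\<^sub>,\<^sub>j\<close> is minus a difference of fluxes.  Summation by parts, whose
  boundary terms vanish by the no-flux condition, moves that difference to the potential, where
  it becomes \<open>- \<Delta>x\<^sub>j u\<close> (\<open>sum_by_parts_no_flux\<close>).  The rate is thus
  \<open>- \<Sum>\<^sub>m \<Sum>\<^sub>j \<Delta>x\<^sub>j u F\<close> over the interior interfaces.  The factor \<open>\<Delta>x\<^sub>j\<close> is the same one
  by which the velocity divides, so the computation is exact on non-uniform grids too.  Finally,
  upwinding makes \<open>F\<close> the velocity times one of the two neighbouring densities, and so
  \<open>u F \<ge> u\<^sup>2 min\<close> (\<open>upwind_flux_dissipates\<close>).
\<close>

lemma symmetric_quadratic_form_has_derivative: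
  fixes A :: "'i \<Rightarrow> 'i \<Rightarrow> real" and r :: "real \<Rightarrow> 'i \<Rightarrow> real"
  assumes sym: "\<And>i j. A i j = A j i"
    and r: "\<And>j. j \<in> S \<Longrightarrow> ((\<lambda>s. r s j) has_real_derivative r' j) (at t within T)"
  shows "((\<lambda>s. 1 / 2 * (\<Sum>i\<in>S. \<Sum>j\<in>S. A i j * r s i * r s j)) has_real_derivative
          (\<Sum>j\<in>S. r' j * (\<Sum>i\<in>S. A i j * r t i))) (at t within T)"
proof -
  have "((\<lambda>s. 1 / 2 * (\<Sum>i\<in>S. \<Sum>j\<in>S. A i j * r s i * r s j)) has_real_derivative
          1 / 2 * (\<Sum>i\<in>S. \<Sum>j\<in>S. A i j * r' i * r t j + A i j * r t i * r' j)) (at t within T)"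
    by (intro DERIV_cmult DERIV_sum) (auto intro!: derivative_eq_intros r simp: algebra_simps)
  moreover have "(\<Sum>i\<in>S. \<Sum>j\<in>S. A i j * r' i * r t j) = (\<Sum>j\<in>S. r' j * (\<Sum>i\<in>S. A i j * r t i))"
    unfolding sum_distrib_left
    by (intro sum.cong refl) (metis sym mult.commute mult.assoc)
  moreover have "(\<Sum>i\<in>S. \<Sum>j\<in>S. A i j * r t i * r' j) = (\<Sum>j\<in>S. r' j * (\<Sum>i\<in>S. A i j * r t i))"
    unfolding sum_distrib_left
    by (subst sum.swap) (intro sum.cong refl, simp add: mult_ac)
  ultimately show ?thesis
    by (simp add: sum.distrib)
qed

lemma entropy_density_has_derivative:
  fixes f :: "real \<Rightarrow> real"
  assumes "(f has_real_derivative f') (at t within T)" "f t > 0"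
  shows "((\<lambda>s. f s * ln (f s)) has_real_derivative f' * (ln (f t) + 1)) (at t within T)"
  using assms by (auto intro!: derivative_eq_intros simp: field_simps)

text \<open>
  The entropy contributes the term \<open>ln c + 1\<close> of the potential.  In an even kernel's quadratic
  form the two slots contribute equally, which leaves the discrete convolution paired with the
  derivative of the charge or of the total density; spreading that derivative over the species
  produces the weights \<open>z m\<close> and \<open>1\<close> with which the convolutions enter the potential.
\<close>

lemma energy_has_derivative:
  fixes c :: "real \<Rightarrow> nat \<Rightarrow> int \<Rightarrow> real"
  assumes K: "\<And>x. K (- x) = K x" and W: "\<And>x. W (- x) = W x"
    and pos: "\<And>m j. m \<in> {1..M} \<Longrightarrow> j \<in> cells Mx \<Longrightarrow> c t m j > 0"
    and c: "\<And>m j. m \<in> {1..M} \<Longrightarrow> j \<in> cells Mx \<Longrightarrow>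
              ((\<lambda>s. c s m j) has_real_derivative c' m j) (at t within T)"
  shows "((\<lambda>s. energy Mx xh M z K W (c s)) has_real_derivative
          (\<Sum>m = 1..M. \<Sum>j\<in>cells Mx. width xh j * c' m j * potential Mx xh M z K W (c t) m j))
          (at t within T)"
proof -
  define S where "S = cells Mx"
  define w where "w = width xh"
  define k where "k i j = w j * w i * K (center xh j - center xh i)" for i j
  define v where "v i j = w j * w i * W (center xh j - center xh i)" for i j
  have k_sym: "k i j = k j i" and v_sym: "v i j = v j i" for i j
    using K[of "center xh i - center xh j"] W[of "center xh i - center xh j"]
    by (simp_all add: k_def v_def)
  have charge': "((\<lambda>s. charge M z (c s) j) has_real_derivative charge M z c' j) (at t within T)"
    if "j \<in> S" for j
    unfolding charge_def using that by (intro DERIV_sum DERIV_cmult c) (auto simp: S_def)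
  have total': "((\<lambda>s. total M (c s) j) has_real_derivative total M c' j) (at t within T)"
    if "j \<in> S" for j
    unfolding total_def using that by (intro DERIV_sum c) (auto simp: S_def)
  have entropy': "((\<lambda>s. \<Sum>m = 1..M. \<Sum>j\<in>S. w j * (c s m j * ln (c s m j))) has_real_derivative
      (\<Sum>m = 1..M. \<Sum>j\<in>S. w j * (c' m j * (ln (c t m j) + 1)))) (at t within T)"
    by (intro DERIV_sum DERIV_cmult entropy_density_has_derivative c pos) (auto simp: S_def)
  have energy_split: "energy Mx xh M z K W d =
      (\<Sum>m = 1..M. \<Sum>j\<in>S. w j * (d m j * ln (d m j)))
      + 1 / 2 * (\<Sum>i\<in>S. \<Sum>j\<in>S. k i j * charge M z d i * charge M z d j)
      + 1 / 2 * (\<Sum>i\<in>S. \<Sum>j\<in>S. v i j * total M d i * total M d j)" for d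
    by (simp add: energy_def S_def w_def k_def v_def sum.distrib distrib_left mult.assoc)
  define P where "P j = (\<Sum>i\<in>S. k i j * charge M z (c t) i)" for j
  define Q where "Q j = (\<Sum>i\<in>S. v i j * total M (c t) i)" for j
  have P_sum: "(\<Sum>j\<in>S. charge M z c' j * P j) = (\<Sum>m = 1..M. \<Sum>j\<in>S. z m * c' m j * P j)"
    unfolding charge_def sum_distrib_right by (rule sum.swap)
  have Q_sum: "(\<Sum>j\<in>S. total M c' j * Q j) = (\<Sum>m = 1..M. \<Sum>j\<in>S. c' m j * Q j)"
    unfolding total_def sum_distrib_right by (rule sum.swap)
  have potential: "w j * potential Mx xh M z K W (c t) m j =
      w j * (ln (c t m j) + 1) + z m * P j + Q j" for m j
    by (simp add: potential_def P_def Q_def S_def w_def k_def v_def sum.distrib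
        distrib_left sum_distrib_left mult_ac)
  have "((\<lambda>s. energy Mx xh M z K W (c s)) has_real_derivative
      (\<Sum>m = 1..M. \<Sum>j\<in>S. w j * (c' m j * (ln (c t m j) + 1)))
      + (\<Sum>j\<in>S. charge M z c' j * P j) + (\<Sum>j\<in>S. total M c' j * Q j)) (at t within T)"
    unfolding energy_split P_def Q_def
    by (intro DERIV_add entropy' symmetric_quadratic_form_has_derivative
        k_sym v_sym charge' total')
  also have "(\<Sum>m = 1..M. \<Sum>j\<in>S. w j * (c' m j * (ln (c t m j) + 1)))
      + (\<Sum>j\<in>S. charge M z c' j * P j) + (\<Sum>j\<in>S. total M c' j * Q j)
      = (\<Sum>m = 1..M. \<Sum>j\<in>S. c' m j * (w j * potential Mx xh M z K W (c t) m j))"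
    unfolding P_sum Q_sum potential sum.distrib[symmetric]
    by (intro sum.cong refl) (simp add: algebra_simps)
  finally show ?thesis
    by (simp add: S_def w_def mult_ac)
qed

lemma sum_by_parts_int:
  fixes G p :: "int \<Rightarrow> real"
  assumes "a \<le> b"
  shows "(\<Sum>j = a..b. (G j - G (j - 1)) * p j) =
         G b * p b - G (a - 1) * p a - (\<Sum>j = a..b - 1. G j * (p (j + 1) - p j))"
  using assms
proof (induction b rule: int_ge_induct)
  case base
  then show ?case by (simp add: algebra_simps)
next
  case (step b)
  have "{a..b + 1} = insert (b + 1) {a..b}" "{a..b} = insert b {a..b - 1}"
    using step.hyps by auto
  with step.IH show ?case by (simp add: algebra_simps)
qed

lemma sum_by_parts_no_flux:
  fixes G p :: "int \<Rightarrow> real"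
  assumes "G (- int Mx - 1) = 0" "G (int Mx) = 0"
  shows "(\<Sum>j\<in>cells Mx. (G j - G (j - 1)) * p j) =
         - (\<Sum>j\<in>interior_interfaces Mx. G j * (p (j + 1) - p j))"
  using sum_by_parts_int[of "- int Mx" "int Mx" G p] assms
  by (simp add: cells_def interior_interfaces_def)

text \<open>
  The upwind density is \<open>c m j\<close> when the velocity is positive and \<open>c m (j + 1)\<close> when it is
  negative; in both cases it is at least the minimum of the two.
\<close>

lemma upwind_flux_dissipates:
  "(velocity Mx xh M z K W c m j)\<^sup>2 * min (c m j) (c m (j + 1))
     \<le> velocity Mx xh M z K W c m j * upwind_flux Mx xh M z K W c m j"
proof -
  define u where "u = velocity Mx xh M z K W c m j"
  have "u * upwind_flux Mx xh M z K W c m j = u\<^sup>2 * (if u \<ge> 0 then c m j else c m (j + 1))"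
    by (simp add: upwind_flux_def u_def Let_def power2_eq_square)
  then show ?thesis
    by (simp add: u_def mult_left_mono)
qed

theorem theorem3p2:
  fixes L :: real and Mx M :: nat and xh :: "int \<Rightarrow> real"
    and z :: "nat \<Rightarrow> int" and K W :: "real \<Rightarrow> real"
    and c0 :: "nat \<Rightarrow> real \<Rightarrow> real"
    and F c :: "real \<Rightarrow> nat \<Rightarrow> int \<Rightarrow> real"
  assumes "is_grid L Mx xh"
    and "\<And>x. K (- x) = K x"
    and "\<And>x. W (- x) = W x"
    and "\<And>m. m \<in> {1..M} \<Longrightarrow> c0 m absolutely_integrable_on {-L..L}"
    and "\<And>m x. m \<in> {1..M} \<Longrightarrow> x \<in> {-L..L} \<Longrightarrow> c0 m x \<ge> 0"
    and "\<And>m j. m \<in> {1..M} \<Longrightarrow> j \<in> cells Mx \<Longrightarrow> c 0 m j = cell_average xh (c0 m) j"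
    and "scheme_solution Mx xh M z K W F c"
    and "no_flux Mx M F"
  shows "\<forall>t \<ge> 0. \<exists>E'.
           ((\<lambda>s. energy Mx xh M z K W (c s)) has_real_derivative E') (at t within {0..}) \<and>
           E' \<le> - dissipation Mx xh M z K W (c t) \<and>
           - dissipation Mx xh M z K W (c t) \<le> 0"
proof (intro allI impI)
  fix t :: real
  assume t: "t \<ge> 0"
  let ?\<psi> = "potential Mx xh M z K W (c t)"
  let ?u = "velocity Mx xh M z K W (c t)"
  let ?E' = "- (\<Sum>m = 1..M. \<Sum>j\<in>interior_interfaces Mx. width xh j * (?u m j * F t m j))"
  have width: "width xh j > 0" if "j \<in> cells Mx" for j
    using assms(1) that unfolding is_grid_def width_def cells_def strict_mono_on_def by simp
  have interior: "j \<in> cells Mx \<and> j + 1 \<in> cells Mx" if "j \<in> interior_interfaces Mx" for j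
    using that by (simp add: cells_def interior_interfaces_def)
  have pos: "c t m j > 0" if "m \<in> {1..M}" "j \<in> cells Mx" for m j
    using assms(7) t that unfolding scheme_solution_def by blast
  have flux: "F t m j = upwind_flux Mx xh M z K W (c t) m j"
    if "m \<in> {1..M}" "j \<in> interior_interfaces Mx" for m j
    using assms(7) t that unfolding scheme_solution_def by blast
  have ode: "((\<lambda>s. c s m j) has_real_derivative - (F t m j - F t m (j - 1)) / width xh j)
      (at t within {0..})" if "m \<in> {1..M}" "j \<in> cells Mx" for m j
    using assms(7) t that unfolding scheme_solution_def by blast

  have rate: "(\<Sum>j\<in>cells Mx. width xh j * (- (F t m j - F t m (j - 1)) / width xh j) * ?\<psi> m j)
      = - (\<Sum>j\<in>interior_interfaces Mx. width xh j * (?u m j * F t m j))"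
    if m: "m \<in> {1..M}" for m
  proof -
    have "(\<Sum>j\<in>cells Mx. width xh j * (- (F t m j - F t m (j - 1)) / width xh j) * ?\<psi> m j)
        = - (\<Sum>j\<in>cells Mx. (F t m j - F t m (j - 1)) * ?\<psi> m j)"
      unfolding sum_negf[symmetric]
    proof (intro sum.cong refl)
      fix j assume "j \<in> cells Mx"
      then show "width xh j * (- (F t m j - F t m (j - 1)) / width xh j) * ?\<psi> m j
          = - ((F t m j - F t m (j - 1)) * ?\<psi> m j)"
        using width[of j] by (simp flip: mult_minus_left)
    qed
    also have "\<dots> = (\<Sum>j\<in>interior_interfaces Mx. F t m j * (?\<psi> m (j + 1) - ?\<psi> m j))"
      using assms(8) t m unfolding no_flux_def by (subst sum_by_parts_no_flux) auto
    also have "\<dots> = - (\<Sum>j\<in>interior_interfaces Mx. width xh j * (?u m j * F t m j))"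
      unfolding sum_negf[symmetric]
    proof (intro sum.cong refl)
      fix j assume "j \<in> interior_interfaces Mx"
      then have "width xh j * ?u m j = - (?\<psi> m (j + 1) - ?\<psi> m j)"
        using width[of j] interior by (simp add: velocity_def)
      then show "F t m j * (?\<psi> m (j + 1) - ?\<psi> m j) = - (width xh j * (?u m j * F t m j))"
        by (simp add: mult.assoc[symmetric]) (simp add: algebra_simps)
    qed
    finally show ?thesis .
  qed
  have "((\<lambda>s. energy Mx xh M z K W (c s)) has_real_derivative
      (\<Sum>m = 1..M. \<Sum>j\<in>cells Mx.
        width xh j * (- (F t m j - F t m (j - 1)) / width xh j) * ?\<psi> m j)) (at t within {0..})"
    by (intro energy_has_derivative assms(2,3) pos ode)
  also have "(\<Sum>m = 1..M. \<Sum>j\<in>cells Mx.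
        width xh j * (- (F t m j - F t m (j - 1)) / width xh j) * ?\<psi> m j) = ?E'"
    unfolding sum_negf[symmetric] by (rule sum.cong[OF refl]) (simp only: rate sum_negf)
  finally have deriv:
    "((\<lambda>s. energy Mx xh M z K W (c s)) has_real_derivative ?E') (at t within {0..})" .
  have bound: "?E' \<le> - dissipation Mx xh M z K W (c t)"
    unfolding dissipation_def neg_le_iff_le
  proof (intro sum_mono)
    fix m j assume "m \<in> {1..M}" and j: "j \<in> interior_interfaces Mx"
    then show "width xh j * (?u m j)\<^sup>2 * min (c t m j) (c t m (j + 1))
        \<le> width xh j * (?u m j * F t m j)"
      using upwind_flux_dissipates width[of j] interior[OF j]
      by (simp add: flux mult.assoc mult_left_mono)
  qed
  have "0 \<le> dissipation Mx xh M z K W (c t)"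
    unfolding dissipation_def
    by (intro sum_nonneg mult_nonneg_nonneg)
      (use interior in \<open>auto intro!: less_imp_le[OF width] less_imp_le[OF pos]\<close>)
  with deriv bound show "\<exists>E'.
      ((\<lambda>s. energy Mx xh M z K W (c s)) has_real_derivative E') (at t within {0..}) \<and>
      E' \<le> - dissipation Mx xh M z K W (c t) \<and> - dissipation Mx xh M z K W (c t) \<le> 0"
    by auto
qed

end
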